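(* Let $F$ be a field with $\mathrm{char}(F)=p>0$, let $A\in F^{n\times n}$ and $0\neq\lambda\in F$. Suppose that the characteristic polynomial $c_A(t)$ factors over $F$ as $c_A(t)=(t-\alpha)^m f(t)$, where $\alpha\in F$, $f(t)\in F[t]$, and $f(\alpha)f(\lambda\alpha)f(\lambda^{-1}\alpha)\neq 0$. Then $A$ is conjugate to a block diagonal matrix $\mathrm{diag}(A_1,A_2)$ where $c_{A_1}(t)=(t-\alpha)^m$, $c_{A_2}(t)=f(t)$, and $$C_F(A,\lambda)\cong C_F(A_1,\lambda)\oplus C_F(A_2,\lambda)$$ as $F$-vector spaces.
   Context: For a field $F$, a square matrix $A\in F^{m\times m}$ and $\lambda\in F$, $C_F(A,\lambda)=\{B\in F^{m\times m}\mid AB-\lambda BA=0\}$ (the zero space when $m=0$). The characteristic polynomial of $A$ is $c_A(t)=\det(tI-A)$. For $F$-subspaces of matrices, $\cong$ means isomorphic as vector spaces. *)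

theory Defs
  imports "Jordan_Normal_Form.Char_Poly" "Jordan_Normal_Form.VS_Connect"
begin

text \<open>The set \<open>C\<^sub>F(A, \<lambda>)\<close> for square \<open>A\<close>; the field \<open>F\<close> is the element type.
  Since \<^term>\<open>carrier_mat 0 0\<close> is a singleton, this is the zero space for a \<open>0 \<times> 0\<close> matrix.\<close>

definition twisted_centralizer :: "'a :: field mat \<Rightarrow> 'a \<Rightarrow> 'a mat set" where
  "twisted_centralizer A l =
     {B \<in> carrier_mat (dim_row A) (dim_row A).
        A * B - l \<cdot>\<^sub>m (B * A) = 0\<^sub>m (dim_row A) (dim_row A)}"

definition twisted_centralizer_space :: "'a :: field mat \<Rightarrow> 'a \<Rightarrow> ('a, 'a mat) module" where
  "twisted_centralizer_space A l =
     (module_mat TYPE('a) (dim_row A) (dim_row A)) \<lparr>carrier := twisted_centralizer A l\<rparr>"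

lemma twisted_centralizer_space_simps [simp]:
  "carrier (twisted_centralizer_space A l) = twisted_centralizer A l"
  "add (twisted_centralizer_space A l) = (+)"
  "zero (twisted_centralizer_space A l) = 0\<^sub>m (dim_row A) (dim_row A)"
  "smult (twisted_centralizer_space A l) = (\<cdot>\<^sub>m)"
  by (simp_all add: twisted_centralizer_space_def module_mat_simps)

text \<open>The locale predicate \<^locale>\<open>linear_map\<close> includes that \<open>V\<close> and \<open>W\<close> are vector spaces over \<open>K\<close>.\<close>

definition vectorspace_iso ::
  "('k, 'r) ring_scheme \<Rightarrow> ('k, 'v, 's) module_scheme \<Rightarrow> ('k, 'w, 't) module_scheme \<Rightarrow> bool" where
  "vectorspace_iso K V W \<longleftrightarrow>
     (\<exists>T. linear_map K V W T \<and> bij_betw T (carrier V) (carrier W))"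

end

theory Submission
  imports Defs
begin

text \<open>
  Two facts about a matrix equation of Sylvester type carry the proof.

  The first is solvability. To separate the eigenvalue \<open>\<alpha>\<close> from the rest of \<open>A\<close>, one copy of \<open>\<alpha>\<close> at a time
  is moved to the bottom right corner of a conjugate of \<open>A\<close> (\<open>similar_split_off_eigenvalue\<close>). The column
  above it couples this copy to the part whose characteristic polynomial is \<open>f\<close>; since \<open>f(\<alpha>) \<noteq> 0\<close>, that
  part minus \<open>\<alpha>\<close> is invertible, and a shear removes the coupling (\<open>similar_block_diagonal_extend\<close>).
  After \<open>m\<close> steps \<open>A\<close> is similar to a block diagonal matrix with an upper triangular block \<open>A1\<close>, all of
  whose diagonal entries are \<open>\<alpha>\<close>, and a block \<open>A2\<close> with characteristic polynomial \<open>f\<close>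
  (\<open>similar_split_root_power\<close>).

  The second is uniqueness. Conjugation does not change the isomorphism type of \<open>C(A, \<lambda>)\<close>, so \<open>A\<close> may be
  taken block diagonal. A block matrix \<open>B\<close> then lies in \<open>C(A, \<lambda>)\<close> if and only if its diagonal blocks lie
  in \<open>C(A1, \<lambda>)\<close> and \<open>C(A2, \<lambda>)\<close> and its off-diagonal blocks satisfy \<open>A1 B2 = B2 (\<lambda> A2)\<close> and
  \<open>A2 B3 = B3 (\<lambda> A1)\<close>. A matrix that intertwines two matrices without a common eigenvalue is zero, one of
  them being triangular (\<open>intertwiner_upper_triangular_left\<close>, \<open>intertwiner_upper_triangular_right\<close>). A
  common eigenvalue would be \<open>\<alpha>\<close> in the first equation and \<open>\<lambda> \<alpha>\<close> in the second, making
  \<open>inverse \<lambda> * \<alpha>\<close> respectively \<open>\<lambda> \<alpha>\<close> a root of \<open>f\<close>. So \<open>B2\<close> and \<open>B3\<close> vanish, and sending \<open>B\<close> to its pair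
  of diagonal blocks is the required isomorphism.
\<close>

section \<open>Intertwiners of matrices without common eigenvalues\<close>

lemma sum_single_term:
  assumes "finite S" "i \<in> S" "\<And>j. j \<in> S \<Longrightarrow> j \<noteq> i \<Longrightarrow> f j = 0"
  shows "sum f S = (f i :: 'b :: comm_monoid_add)"
  using assms by (simp add: sum.remove sum.neutral)

text \<open>The rows of \<open>B\<close> vanish from the bottom up, by the triangular shape of \<open>U\<close>: once all rows
  below row \<open>i\<close> are zero, the equation says that row \<open>i\<close>, read as a column vector, is mapped by the
  transpose of \<open>M\<close> to its multiple by the \<open>i\<close>-th diagonal entry of \<open>U\<close>, so a nonzero row would make
  that entry an eigenvalue of \<open>M\<close>.\<close>

lemma intertwiner_upper_triangular_left:
  fixes U :: "'a :: field mat"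
  assumes U: "U \<in> carrier_mat m m" and ut: "upper_triangular U"
    and M: "M \<in> carrier_mat k k" and B: "B \<in> carrier_mat m k"
    and eq: "U * B = B * M"
    and ev: "\<And>i. i < m \<Longrightarrow> \<not> eigenvalue M (U $$ (i,i))"
  shows "B = 0\<^sub>m m k"
proof -
  have rows: "row B i = 0\<^sub>v k" if "i < m" for i
    using that
  proof (induct "m - i" arbitrary: i rule: less_induct)
    case less
    have below: "row B j = 0\<^sub>v k" if "i < j" "j < m" for j
      using less(1)[of j] less(2) that by auto
    let ?r = "row B i"
    have r: "?r \<in> carrier_vec k" using B by auto
    have "(transpose_mat M *\<^sub>v ?r) $ c = (U $$ (i,i) \<cdot>\<^sub>v ?r) $ c" if c: "c < k" for c
    proof -
      have zero: "U $$ (i,j) * B $$ (j,c) = 0" if "j < m" "j \<noteq> i" for j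
      proof (cases "j < i")
        case True
        then show ?thesis using upper_triangularD[OF ut True] U less(2) by simp
      next
        case False
        then have "row B j $ c = 0" using below[of j] that c by simp
        then show ?thesis using B that c by simp
      qed
      have "(transpose_mat M *\<^sub>v ?r) $ c = (B * M) $$ (i,c)"
        using M B less(2) c by (simp add: comm_scalar_prod[of _ k])
      also have "\<dots> = (U * B) $$ (i,c)" by (simp add: eq)
      also have "\<dots> = (\<Sum>j\<in>{0..<m}. U $$ (i,j) * B $$ (j,c))"
        using U B less(2) c by (auto simp: scalar_prod_def intro!: sum.cong)
      also have "\<dots> = U $$ (i,i) * B $$ (i,c)"
        using less(2) by (intro sum_single_term zero) auto
      finally show ?thesis using B less(2) c by simp
    qed
    then have "transpose_mat M *\<^sub>v ?r = U $$ (i,i) \<cdot>\<^sub>v ?r"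
      using M B by (intro eq_vecI) auto
    moreover have "\<not> eigenvalue (transpose_mat M) (U $$ (i,i))"
      using ev[OF less(2)] M by (simp add: eigenvalue_root_char_poly[of _ k])
    ultimately show ?case
      using r M unfolding eigenvalue_def eigenvector_def by auto
  qed
  show ?thesis
  proof (rule eq_matI)
    fix i j assume "i < dim_row (0\<^sub>m m k :: 'a mat)" "j < dim_col (0\<^sub>m m k :: 'a mat)"
    then show "B $$ (i,j) = 0\<^sub>m m k $$ (i,j)"
      using arg_cong[OF rows[of i], of "\<lambda>v. v $ j"] B by simp
  qed (use B in auto)
qed

text \<open>The mirror image: here the columns of \<open>B\<close> vanish from left to right, each being a candidate
  eigenvector of \<open>M\<close> itself.\<close>

lemma intertwiner_upper_triangular_right:
  fixes U :: "'a :: field mat"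
  assumes U: "U \<in> carrier_mat m m" and ut: "upper_triangular U"
    and M: "M \<in> carrier_mat k k" and B: "B \<in> carrier_mat k m"
    and eq: "M * B = B * U"
    and ev: "\<And>i. i < m \<Longrightarrow> \<not> eigenvalue M (U $$ (i,i))"
  shows "B = 0\<^sub>m k m"
proof -
  have cols: "col B i = 0\<^sub>v k" if "i < m" for i
    using that
  proof (induct i rule: less_induct)
    case (less i)
    let ?c = "col B i"
    have c: "?c \<in> carrier_vec k" using B by auto
    have "(M *\<^sub>v ?c) $ r = (U $$ (i,i) \<cdot>\<^sub>v ?c) $ r" if r: "r < k" for r
    proof -
      have zero: "B $$ (r,j) * U $$ (j,i) = 0" if "j < m" "j \<noteq> i" for j
      proof (cases "i < j")
        case True
        then show ?thesis using upper_triangularD[OF ut True] U that by simp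
      next
        case False
        then have "col B j $ r = 0" using less(1)[of j] that r by simp
        then show ?thesis using B that r by simp
      qed
      have "(M *\<^sub>v ?c) $ r = (M * B) $$ (r,i)" using M B less(2) r by simp
      also have "\<dots> = (B * U) $$ (r,i)" by (simp add: eq)
      also have "\<dots> = (\<Sum>j\<in>{0..<m}. B $$ (r,j) * U $$ (j,i))"
        using U B less(2) r by (auto simp: scalar_prod_def intro!: sum.cong)
      also have "\<dots> = B $$ (r,i) * U $$ (i,i)"
        using less(2) by (intro sum_single_term zero) auto
      finally show ?thesis using B less(2) r by simp
    qed
    then have "M *\<^sub>v ?c = U $$ (i,i) \<cdot>\<^sub>v ?c"
      using M B by (intro eq_vecI) auto
    then show ?case
      using ev[OF less(2)] c M unfolding eigenvalue_def eigenvector_def by auto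
  qed
  show ?thesis
  proof (rule eq_matI)
    fix i j assume "i < dim_row (0\<^sub>m k m :: 'a mat)" "j < dim_col (0\<^sub>m k m :: 'a mat)"
    then show "B $$ (i,j) = 0\<^sub>m k m $$ (i,j)"
      using arg_cong[OF cols[of j], of "\<lambda>v. v $ i"] B by simp
  qed (use B in auto)
qed

lemma eigenvalue_smult:
  fixes A :: "'a :: field mat"
  assumes A: "A \<in> carrier_mat n n" and ev: "eigenvalue (c \<cdot>\<^sub>m A) a" and c: "c \<noteq> 0"
  shows "eigenvalue A (inverse c * a)"
proof -
  from ev obtain v where v: "v \<in> carrier_vec n" "v \<noteq> 0\<^sub>v n" and eq: "(c \<cdot>\<^sub>m A) *\<^sub>v v = a \<cdot>\<^sub>v v"
    using A unfolding eigenvalue_def eigenvector_def by auto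
  have "A *\<^sub>v v = (inverse c * a) \<cdot>\<^sub>v v"
  proof (rule eq_vecI)
    fix i assume "i < dim_vec ((inverse c * a) \<cdot>\<^sub>v v)"
    then have "i < n" using v by simp
    then show "(A *\<^sub>v v) $ i = ((inverse c * a) \<cdot>\<^sub>v v) $ i"
      using arg_cong[OF eq, of "\<lambda>w. w $ i"] A v c by (simp add: field_simps)
  qed (use A v in auto)
  then show ?thesis using v A unfolding eigenvalue_def eigenvector_def by auto
qed

section \<open>Similarity of block triangular matrices\<close>

lemma char_poly_block_upper_triangular:
  fixes A :: "'a :: idom mat"
  assumes A: "A \<in> carrier_mat n n" and X: "X \<in> carrier_mat n k" and D: "D \<in> carrier_mat k k"
  shows "char_poly (four_block_mat A X (0\<^sub>m k n) D) = char_poly A * char_poly D"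
proof -
  have "char_poly_matrix (four_block_mat A X (0\<^sub>m k n) D) =
      four_block_mat (char_poly_matrix A) (map_mat (\<lambda>a. [:- a:]) X) (0\<^sub>m k n) (char_poly_matrix D)"
    using assms by (intro eq_matI) (auto simp: char_poly_matrix_def one_poly_def)
  then show ?thesis unfolding char_poly_def
    using assms by (simp add: det_four_block_mat_lower_left_zero[of _ n _ k])
qed

text \<open>Conjugation by a unipotent block matrix changes the off-diagonal block by a Sylvester expression.
  Hence that block can be altered by every value of \<open>Y * D - A * Y\<close>.\<close>

lemma similar_shear:
  fixes A :: "'a :: ring_1 mat"
  assumes A: "A \<in> carrier_mat n n" and D: "D \<in> carrier_mat k k"
    and X: "X \<in> carrier_mat n k" and Y: "Y \<in> carrier_mat n k"
  shows "similar_mat (four_block_mat A (X + Y * D - A * Y) (0\<^sub>m k n) D)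
    (four_block_mat A X (0\<^sub>m k n) D)"
proof -
  let ?P = "four_block_mat (1\<^sub>m n) Y (0\<^sub>m k n) (1\<^sub>m k)"
  let ?Q = "four_block_mat (1\<^sub>m n) (- Y) (0\<^sub>m k n) (1\<^sub>m k)"
  let ?B = "four_block_mat A X (0\<^sub>m k n) D"
  have [simp]: "- 0\<^sub>m k k = (0\<^sub>m k k :: 'a mat)" "- Y + Y = 0\<^sub>m n k" "Y + - Y = 0\<^sub>m n k"
    using Y by auto
  have inv: "?P * ?Q = 1\<^sub>m (n + k)" "?Q * ?P = 1\<^sub>m (n + k)"
    using Y by (subst mult_four_block_mat[of _ n n _ k _ k _ _ n _ k]; simp)+
  have PB: "?P * ?B = four_block_mat A (X + Y * D) (0\<^sub>m k n) D"
    using assms by (subst mult_four_block_mat[of _ n n _ k _ k _ _ n _ k]; simp)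
  have "X + Y * D - A * Y = - (A * Y) + (X + Y * D)"
    using assms by (intro eq_matI) auto
  then have "?P * ?B * ?Q = four_block_mat A (X + Y * D - A * Y) (0\<^sub>m k n) D"
    unfolding PB using assms by (subst mult_four_block_mat[of _ n n _ k _ k _ _ n _ k]; simp)
  then show ?thesis
    using assms inv by (intro similar_matI[of _ _ ?P ?Q "n + k"]) auto
qed

lemma similar_swap_blocks:
  fixes A :: "'a :: ring_1 mat"
  assumes A: "A \<in> carrier_mat n n" and D: "D \<in> carrier_mat k k"
  shows "similar_mat (four_block_mat A (0\<^sub>m n k) (0\<^sub>m k n) D)
    (four_block_mat D (0\<^sub>m k n) (0\<^sub>m n k) A)"
proof -
  let ?P = "four_block_mat (0\<^sub>m n k) (1\<^sub>m n) (1\<^sub>m k) (0\<^sub>m k n) :: 'a mat"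
  let ?Q = "four_block_mat (0\<^sub>m k n) (1\<^sub>m k) (1\<^sub>m n) (0\<^sub>m n k) :: 'a mat"
  let ?B = "four_block_mat D (0\<^sub>m k n) (0\<^sub>m n k) A"
  have carr: "?P \<in> carrier_mat (n + k) (n + k)" "?Q \<in> carrier_mat (n + k) (n + k)"
      "?B \<in> carrier_mat (n + k) (n + k)"
    using assms by (intro carrier_matI; simp)+
  have PQ: "?P * ?Q = 1\<^sub>m (n + k)"
    by (subst mult_four_block_mat[of _ n k _ n _ k _ _ n _ k]; simp)
  have QP: "?Q * ?P = 1\<^sub>m (n + k)"
    by (subst mult_four_block_mat[of _ k n _ k _ n _ _ k _ n]; simp add: add.commute[of k])
  have PB: "?P * ?B = four_block_mat (0\<^sub>m n k) A D (0\<^sub>m k n)"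
    using assms by (subst mult_four_block_mat[of _ n k _ n _ k _ _ k _ n]; simp)
  have "?P * ?B * ?Q = four_block_mat A (0\<^sub>m n k) (0\<^sub>m k n) D"
    unfolding PB using assms by (subst mult_four_block_mat[of _ n k _ n _ k _ _ n _ k]; simp)
  then show ?thesis
    using assms PQ QP carr
    by (intro similar_matI[of _ _ ?P ?Q "n + k"]) simp_all
qed

text \<open>A root of the characteristic polynomial can be moved to the bottom right corner. Row reduction turns
  the singular matrix \<open>A - \<alpha>\<close> into one whose last row is zero; if \<open>P\<close> records the row operations, then
  \<open>P * (A - \<alpha>) * inverse P\<close> still has a zero last row, and adding \<open>\<alpha>\<close> back gives the conjugate of \<open>A\<close>
  that is wanted.\<close>

lemma similar_split_off_eigenvalue:
  fixes A :: "'a :: field mat"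
  assumes A: "A \<in> carrier_mat n n" and root: "poly (char_poly A) \<alpha> = 0"
  shows "\<exists>n' A' x. n = n' + 1 \<and> A' \<in> carrier_mat n' n' \<and> x \<in> carrier_mat n' 1 \<and>
    similar_mat A (four_block_mat A' x (0\<^sub>m 1 n') (\<alpha> \<cdot>\<^sub>m 1\<^sub>m 1))"
proof -
  let ?C = "char_matrix A \<alpha>"
  have C: "?C \<in> carrier_mat n n" using A by simp
  have "det ?C = 0"
    using root A by (simp add: eigenvalue_root_char_poly[symmetric] eigenvalue_det[of _ n])
  from det_zero_imp_zero_row[OF C this, of "()"] obtain P
    where P: "P \<in> Units (ring_mat TYPE('a) n ())" and row: "row (P * ?C) (n - 1) = 0\<^sub>v n" and n: "0 < n"
    by blast
  from P obtain Q where Pc: "P \<in> carrier_mat n n" and Q: "Q \<in> carrier_mat n n"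
    and QP: "Q * P = 1\<^sub>m n" and PQ: "P * Q = 1\<^sub>m n"
    unfolding Units_def ring_mat_simps by auto
  define B where "B = P * A * Q"
  have B: "B \<in> carrier_mat n n" using Pc Q A unfolding B_def by auto
  have "P * ?C * Q = B + (- \<alpha>) \<cdot>\<^sub>m 1\<^sub>m n"
  proof -
    have "P * ?C * Q = (P * A + P * ((- \<alpha>) \<cdot>\<^sub>m 1\<^sub>m n)) * Q"
      using Pc A by (simp add: char_matrix_def mult_add_distrib_mat[of _ n n])
    also have "P * ((- \<alpha>) \<cdot>\<^sub>m 1\<^sub>m n) = (- \<alpha>) \<cdot>\<^sub>m P"
      using Pc by (subst mult_smult_distrib[OF Pc, of _ n]) auto
    also have "(P * A + (- \<alpha>) \<cdot>\<^sub>m P) * Q = P * A * Q + (- \<alpha>) \<cdot>\<^sub>m P * Q"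
      using Pc A Q by (intro add_mult_distrib_mat[of _ n n]) auto
    also have "(- \<alpha>) \<cdot>\<^sub>m P * Q = (- \<alpha>) \<cdot>\<^sub>m (1\<^sub>m n)"
      using mult_smult_assoc_mat[OF Pc Q] PQ by simp
    finally show ?thesis unfolding B_def .
  qed
  moreover have "(P * ?C * Q) $$ (n - 1, j) = 0" if "j < n" for j
  proof -
    have "(P * ?C * Q) $$ (n - 1, j) = row (P * ?C) (n - 1) \<bullet> col Q j"
      using Pc C Q n that by (intro index_mult_mat) auto
    then show ?thesis using Q that unfolding row by auto
  qed
  ultimately have last: "B $$ (n - 1, j) = (if j = n - 1 then \<alpha> else 0)" if "j < n" for j
    using that n B by (auto simp: fun_eq_iff split: if_splits)
  define n' where "n' = n - 1"
  have n': "n = n' + 1" using n unfolding n'_def by simp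
  obtain A' x z d where s: "split_block B n' n' = (A', x, z, d)" by (cases "split_block B n' n'")
  have dims: "dim_row B = n' + 1" "dim_col B = n' + 1" using B n' by auto
  note split = split_block[OF s dims]
  have "z = 0\<^sub>m 1 n'" "d = \<alpha> \<cdot>\<^sub>m 1\<^sub>m 1"
    using s last B n' unfolding split_block_def Let_def by auto
  moreover have "A = Q * B * P"
  proof -
    have "Q * B * P = Q * P * A * (Q * P)"
      unfolding B_def using A Pc Q by (simp add: assoc_mult_mat[of _ n n _ n _ n])
    then show ?thesis using QP A by simp
  qed
  then have "similar_mat A B"
    using A B Pc Q QP PQ by (intro similar_matI[of _ _ Q P n]) auto
  ultimately have "similar_mat A (four_block_mat A' x (0\<^sub>m 1 n') (\<alpha> \<cdot>\<^sub>m 1\<^sub>m 1))"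
    using split(5) by simp
  then show ?thesis using split(2,4) split(1) n' by blast
qed

lemma invertible_char_matrix:
  fixes A :: "'a :: field mat"
  assumes A: "A \<in> carrier_mat n n" and "poly (char_poly A) \<alpha> \<noteq> 0"
  obtains R where "R \<in> carrier_mat n n" "char_matrix A \<alpha> * R = 1\<^sub>m n"
proof -
  have "det (char_matrix A \<alpha>) \<noteq> 0"
    using assms by (simp add: eigenvalue_root_char_poly[symmetric] eigenvalue_det[of _ n])
  from det_non_zero_imp_unit[OF char_matrix_closed[OF A] this, of "()"] that show ?thesis
    unfolding Units_def ring_mat_simps by auto
qed

text \<open>A one-dimensional block \<open>\<alpha>\<close> attached to a block diagonal matrix can be detached from every block that
  does not have \<open>\<alpha>\<close> as an eigenvalue: the coupling \<open>u\<close> to \<open>A2\<close> is removed by a shear, whose entry \<open>y\<close>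
  must satisfy \<open>\<alpha> y - A2 y = u\<close>, which is solvable because \<open>A2 - \<alpha>\<close> is invertible. The coupling \<open>w\<close> to
  \<open>A1\<close> stays, and \<open>A1\<close> grows to a block triangular matrix.\<close>

lemma similar_block_diagonal_extend:
  fixes A1 A2 :: "'a :: field mat"
  assumes A1: "A1 \<in> carrier_mat m m" and A2: "A2 \<in> carrier_mat k k"
    and x: "x \<in> carrier_mat (k + m) 1" and nroot: "poly (char_poly A2) \<alpha> \<noteq> 0"
  shows "\<exists>w \<in> carrier_mat m 1.
    similar_mat
      (four_block_mat (four_block_mat A2 (0\<^sub>m k m) (0\<^sub>m m k) A1) x (0\<^sub>m 1 (k + m)) (\<alpha> \<cdot>\<^sub>m 1\<^sub>m 1))
      (four_block_mat A2 (0\<^sub>m k (m + 1)) (0\<^sub>m (m + 1) k)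
        (four_block_mat A1 w (0\<^sub>m 1 m) (\<alpha> \<cdot>\<^sub>m 1\<^sub>m 1)))"
proof -
  let ?N = "four_block_mat A2 (0\<^sub>m k m) (0\<^sub>m m k) A1"
  let ?D = "\<alpha> \<cdot>\<^sub>m 1\<^sub>m 1 :: 'a mat"
  define u where "u = mat k 1 (\<lambda>(i,j). x $$ (i,j))"
  define w where "w = mat m 1 (\<lambda>(i,j). x $$ (i + k,j))"
  have u: "u \<in> carrier_mat k 1" and w: "w \<in> carrier_mat m 1" unfolding u_def w_def by auto
  \<comment> \<open>The minus sign is there because \<open>char_matrix A2 \<alpha>\<close> is \<open>A2 - \<alpha>\<close>, whereas \<open>\<alpha> - A2\<close> must be
    inverted.\<close>
  obtain R where R: "R \<in> carrier_mat k k" and CR: "char_matrix A2 \<alpha> * R = 1\<^sub>m k"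
    using invertible_char_matrix[OF A2 nroot] .
  define y where "y = - (R * u)"
  have y: "y \<in> carrier_mat k 1" using R u unfolding y_def by auto
  have u_eq: "u = \<alpha> \<cdot>\<^sub>m y - A2 * y"
  proof -
    have C: "char_matrix A2 \<alpha> \<in> carrier_mat k k" using A2 by simp
    have "char_matrix A2 \<alpha> * y = - (char_matrix A2 \<alpha> * (R * u))"
      unfolding y_def using R u carrier_matD(2)[OF C] by (intro uminus_mult_right_mat) simp
    also have "char_matrix A2 \<alpha> * (R * u) = u"
      using C R u CR by (simp flip: assoc_mult_mat[OF C R u])
    finally have "- u = char_matrix A2 \<alpha> * y" by simp
    also have "\<dots> = A2 * y + (- \<alpha>) \<cdot>\<^sub>m 1\<^sub>m k * y"
      unfolding char_matrix_def using A2 y by (subst add_mult_distrib_mat[of _ k k]) auto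
    also have "(- \<alpha>) \<cdot>\<^sub>m 1\<^sub>m k * y = (- \<alpha>) \<cdot>\<^sub>m y"
      using y by (subst mult_smult_assoc_mat[of _ k k]) auto
    finally have *: "- u = A2 * y + (- \<alpha>) \<cdot>\<^sub>m y" .
    show ?thesis
    proof (rule eq_matI)
      fix i j assume "i < dim_row (\<alpha> \<cdot>\<^sub>m y - A2 * y)" "j < dim_col (\<alpha> \<cdot>\<^sub>m y - A2 * y)"
      then have ij: "i < k" "j < 1" using A2 y by auto
      then have "- (u $$ (i,j)) = (A2 * y) $$ (i,j) - \<alpha> * y $$ (i,j)"
        using arg_cong[OF *, of "\<lambda>M. M $$ (i,j)"] u A2 y by (simp del: index_mult_mat(1))
      then show "u $$ (i,j) = (\<alpha> \<cdot>\<^sub>m y - A2 * y) $$ (i,j)"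
        using ij A2 y by (simp del: index_mult_mat(1) add: algebra_simps)
    qed (use u A2 y in auto)
  qed
  \<comment> \<open>Columns are written as block matrices with an empty second block column, so that block
    multiplication applies to them.\<close>
  let ?X = "four_block_mat (0\<^sub>m k 1) (0\<^sub>m k 0) w (0\<^sub>m m 0)"
  let ?Y = "four_block_mat y (0\<^sub>m k 0) (0\<^sub>m m 1) (0\<^sub>m m 0)"
  have N: "?N \<in> carrier_mat (k + m) (k + m)" using A1 A2 by simp
  have X: "?X \<in> carrier_mat (k + m) 1" and Y: "?Y \<in> carrier_mat (k + m) 1"
    using w y by auto
  have NY: "?N * ?Y = four_block_mat (A2 * y) (0\<^sub>m k 0) (0\<^sub>m m 1) (0\<^sub>m m 0)"
    using A1 A2 y by (subst mult_four_block_mat[of _ k k _ m _ m _ _ 1 _ 0]; simp)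
  have YD: "?Y * ?D = \<alpha> \<cdot>\<^sub>m ?Y"
    by (simp only: mult_smult_distrib[OF Y one_carrier_mat] right_mult_one_mat[OF Y])
  have x_eq: "?X + ?Y * ?D - ?N * ?Y = x"
  proof (rule eq_matI)
    fix i j assume "i < dim_row x" "j < dim_col x"
    then have ij: "i < k + m" "j = 0" using x by auto
    show "(?X + ?Y * ?D - ?N * ?Y) $$ (i,j) = x $$ (i,j)"
    proof (cases "i < k")
      case True
      then have "x $$ (i,j) = (\<alpha> \<cdot>\<^sub>m y - A2 * y) $$ (i,j)"
        using ij unfolding u_eq[symmetric] u_def by simp
      then show ?thesis
        unfolding NY YD using True ij A1 A2 y w by (simp del: index_mult_mat(1))
    next
      case False
      then show ?thesis
        unfolding NY YD using ij A1 A2 y w by (simp add: w_def)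
    qed
  qed (use x A2 A1 y w in auto)
  have "four_block_mat ?N ?X (0\<^sub>m 1 (k + m)) ?D =
      four_block_mat A2 (0\<^sub>m k (m + 1)) (0\<^sub>m (m + 1) k) (four_block_mat A1 w (0\<^sub>m 1 m) ?D)"
    using A1 A2 w by (intro eq_matI) auto
  with similar_shear[OF N _ X Y, of ?D] w show ?thesis
    unfolding x_eq by auto
qed

text \<open>Iterating the two previous steps peels off the \<open>m\<close> factors belonging to \<open>\<alpha>\<close>. What remains has
  characteristic polynomial \<open>f\<close> by cancellation. The block \<open>A1\<close> comes second because eigenvalues are split off at the bottom right.\<close>

lemma similar_split_root_power:
  fixes A :: "'a :: field mat"
  assumes "A \<in> carrier_mat n n" and "char_poly A = [:- \<alpha>, 1:] ^ m * f" and nroot: "poly f \<alpha> \<noteq> 0"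
  shows "\<exists>k A1 A2. A1 \<in> carrier_mat m m \<and> upper_triangular A1 \<and> (\<forall>i < m. A1 $$ (i,i) = \<alpha>) \<and>
    A2 \<in> carrier_mat k k \<and> char_poly A2 = f \<and>
    similar_mat A (four_block_mat A2 (0\<^sub>m k m) (0\<^sub>m m k) A1)"
  using assms(1,2)
proof (induct m arbitrary: A n)
  case 0
  have "four_block_mat A (0\<^sub>m n 0) (0\<^sub>m 0 n) (0\<^sub>m 0 0) = A"
    using 0(1) by (intro eq_matI) auto
  then show ?case
    using 0 by (intro exI[of _ n] exI[of _ "0\<^sub>m 0 0"] exI[of _ A]) (auto intro: similar_mat_refl)
next
  case (Suc m)
  let ?D = "\<alpha> \<cdot>\<^sub>m 1\<^sub>m 1 :: 'a mat"
  have "poly (char_poly A) \<alpha> = 0" unfolding Suc(3) by simp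
  from similar_split_off_eigenvalue[OF Suc(2) this] obtain n' A' x
    where A': "A' \<in> carrier_mat n' n'" and x: "x \<in> carrier_mat n' 1"
      and sim1: "similar_mat A (four_block_mat A' x (0\<^sub>m 1 n') ?D)"
    by blast
  have "char_poly A = char_poly A' * char_poly ?D"
    unfolding char_poly_similar[OF sim1] using A' x
    by (intro char_poly_block_upper_triangular) auto
  also have "char_poly ?D = [:- \<alpha>, 1:]"
    by (simp add: char_poly_defs det_single)
  finally have "[:- \<alpha>, 1:] * char_poly A' = [:- \<alpha>, 1:] * ([:- \<alpha>, 1:] ^ m * f)"
    unfolding Suc(3) by (simp add: ac_simps)
  then have "char_poly A' = [:- \<alpha>, 1:] ^ m * f"
    by (subst (asm) mult_left_cancel) simp_all
  from Suc(1)[OF A' this] obtain k A1 A2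
    where A1: "A1 \<in> carrier_mat m m" and ut: "upper_triangular A1"
      and diag: "\<forall>i < m. A1 $$ (i,i) = \<alpha>"
      and A2: "A2 \<in> carrier_mat k k" and f: "char_poly A2 = f"
      and sim2: "similar_mat A' (four_block_mat A2 (0\<^sub>m k m) (0\<^sub>m m k) A1)"
    by blast
  let ?N = "four_block_mat A2 (0\<^sub>m k m) (0\<^sub>m m k) A1"
  have n': "n' = k + m"
  proof -
    from similar_matD[OF sim2] obtain q where "A' \<in> carrier_mat q q" "?N \<in> carrier_mat q q"
      by blast
    with A' four_block_carrier_mat[OF A2 A1] show ?thesis
      by (metis carrier_matD(1))
  qed
  from similar_mat_four_block_0_ex[OF sim2 similar_mat_refl x A', of ?D 1]
  obtain x' where x': "x' \<in> carrier_mat (k + m) 1"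
    and sim3: "similar_mat (four_block_mat A' x (0\<^sub>m 1 n') ?D) (four_block_mat ?N x' (0\<^sub>m 1 (k + m)) ?D)"
    using n' by auto
  from similar_block_diagonal_extend[OF A1 A2 x' nroot[folded f]] obtain w
    where w: "w \<in> carrier_mat m 1"
      and sim4: "similar_mat (four_block_mat ?N x' (0\<^sub>m 1 (k + m)) ?D)
        (four_block_mat A2 (0\<^sub>m k (m + 1)) (0\<^sub>m (m + 1) k) (four_block_mat A1 w (0\<^sub>m 1 m) ?D))"
    by blast
  let ?A1 = "four_block_mat A1 w (0\<^sub>m 1 m) ?D"
  have "upper_triangular ?A1"
    using A1 ut by (intro upper_triangular_four_block[of _ m]) auto
  moreover have "\<forall>i < Suc m. ?A1 $$ (i,i) = \<alpha>"
    using A1 diag by auto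
  moreover have "?A1 \<in> carrier_mat (Suc m) (Suc m)"
    using A1 by auto
  moreover have "similar_mat A (four_block_mat A2 (0\<^sub>m k (Suc m)) (0\<^sub>m (Suc m) k) ?A1)"
    using similar_mat_trans[OF sim1 similar_mat_trans[OF sim3 sim4]] by simp
  ultimately show ?case using A2 f by blast
qed

section \<open>Twisted centralizers as vector spaces\<close>

lemma vectorspace_isoI:
  assumes "vectorspace K V" "vectorspace K W" and "bij_betw T (carrier V) (carrier W)"
    and "\<And>x y. x \<in> carrier V \<Longrightarrow> y \<in> carrier V \<Longrightarrow> T (x \<oplus>\<^bsub>V\<^esub> y) = T x \<oplus>\<^bsub>W\<^esub> T y"
    and "\<And>c x. c \<in> carrier K \<Longrightarrow> x \<in> carrier V \<Longrightarrow> T (c \<odot>\<^bsub>V\<^esub> x) = c \<odot>\<^bsub>W\<^esub> T x"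
  shows "vectorspace_iso K V W"
  unfolding vectorspace_iso_def linear_map_def mod_hom_def mod_hom_axioms_def module_hom_def
  using assms bij_betwE[OF assms(3)] by (intro exI[of _ T]) (auto simp: vectorspace_def)

lemma vectorspace_iso_trans:
  assumes "vectorspace_iso K U V" and "vectorspace_iso K V W"
  shows "vectorspace_iso K U W"
proof -
  from assms obtain S T where S: "linear_map K U V S" "bij_betw S (carrier U) (carrier V)"
    and T: "linear_map K V W T" "bij_betw T (carrier V) (carrier W)"
    unfolding vectorspace_iso_def by blast
  interpret S: linear_map K U V S by (rule S(1))
  interpret T: linear_map K V W T by (rule T(1))
  show ?thesis
  proof (rule vectorspace_isoI[of _ _ _ "T \<circ> S"])
    show "bij_betw (T \<circ> S) (carrier U) (carrier W)"
      using S(2) T(2) by (rule bij_betw_trans)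
  qed (use bij_betwE[OF S(2)] S.V.vectorspace_axioms T.W.vectorspace_axioms in auto)
qed

lemma mem_twisted_centralizer:
  assumes "A \<in> carrier_mat n n"
  shows "B \<in> twisted_centralizer A l \<longleftrightarrow> B \<in> carrier_mat n n \<and> A * B = l \<cdot>\<^sub>m (B * A)"
proof -
  have "A * B - l \<cdot>\<^sub>m (B * A) = 0\<^sub>m n n \<longleftrightarrow> A * B = l \<cdot>\<^sub>m (B * A)" if B: "B \<in> carrier_mat n n"
  proof
    assume *: "A * B - l \<cdot>\<^sub>m (B * A) = 0\<^sub>m n n"
    show "A * B = l \<cdot>\<^sub>m (B * A)"
    proof (rule eq_matI)
      fix i j assume ij: "i < dim_row (l \<cdot>\<^sub>m (B * A))" "j < dim_col (l \<cdot>\<^sub>m (B * A))"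
      then show "(A * B) $$ (i,j) = (l \<cdot>\<^sub>m (B * A)) $$ (i,j)"
        using arg_cong[OF *, of "\<lambda>M. M $$ (i,j)"] assms B by simp
    qed (use assms B in auto)
  next
    assume "A * B = l \<cdot>\<^sub>m (B * A)"
    then show "A * B - l \<cdot>\<^sub>m (B * A) = 0\<^sub>m n n"
      using assms B by (intro eq_matI) auto
  qed
  then show ?thesis
    using assms unfolding twisted_centralizer_def by auto
qed

lemma vectorspace_twisted_centralizer:
  fixes A :: "'a :: field mat"
  assumes A: "A \<in> carrier_mat n n"
  shows "vectorspace class_ring (twisted_centralizer_space A l)"
proof -
  let ?M = "module_mat TYPE('a) n n"
  have vs: "vectorspace (class_ring :: 'a ring) ?M" by (rule matrix_vs)
  then interpret vectorspace "class_ring :: 'a ring" ?M .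
  have smult_left_commute: "c \<cdot>\<^sub>m (l \<cdot>\<^sub>m X) = l \<cdot>\<^sub>m (c \<cdot>\<^sub>m X)" for c and X :: "'a mat"
    by (intro eq_matI) (auto simp: ac_simps)
  have "submodule class_ring (twisted_centralizer A l) ?M"
  proof (rule submodule.intro)
    show "module (class_ring :: 'a ring) ?M" using vs by (simp add: vectorspace_def)
  qed (use A in \<open>auto simp: mem_twisted_centralizer[OF A] module_mat_simps
      mult_add_distrib_mat[of _ n n] add_mult_distrib_mat[of _ n n] add_smult_distrib_left_mat[of _ n n]
      mult_smult_distrib[of _ n n] mult_smult_assoc_mat[of _ n n] smult_left_commute\<close>)
  with vs have "subspace class_ring (twisted_centralizer A l) ?M"
    unfolding subspace_def by simp
  from subspace_is_vs[OF this] show ?thesis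
    using A unfolding twisted_centralizer_space_def by simp
qed

lemma twisted_centralizer_conjugate:
  assumes wit: "similar_mat_wit A A' P Q" and A: "A \<in> carrier_mat n n"
    and B: "B \<in> twisted_centralizer A l"
  shows "Q * B * P \<in> twisted_centralizer A' l"
proof -
  note w = similar_mat_witD2[OF A wit]
  have Bc: "B \<in> carrier_mat n n" and eq: "A * B = l \<cdot>\<^sub>m (B * A)"
    using B mem_twisted_centralizer[OF A] by auto
  have A'_eq: "A' = Q * A * P"
    using similar_mat_witD2(3)[OF w(5) similar_mat_wit_sym[OF wit]] .
  have "A' * (Q * B * P) = Q * A * (P * Q) * B * P"
    unfolding A'_eq using A Bc w(6,7) by (simp add: assoc_mult_mat[of _ n n _ n _ n])
  also have "\<dots> = Q * (A * B) * P"
    using A Bc w(6,7) unfolding w(1) by (simp add: assoc_mult_mat[of _ n n _ n _ n])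
  also have "\<dots> = l \<cdot>\<^sub>m (Q * (B * A) * P)"
    using A Bc w(6,7) unfolding eq
    by (simp add: mult_smult_distrib[of _ n n _ n] mult_smult_assoc_mat[of _ n n _ n])
  also have "Q * (B * A) * P = Q * B * (P * Q) * A * P"
    using A Bc w(6,7) unfolding w(1) by (simp add: assoc_mult_mat[of _ n n _ n _ n])
  also have "\<dots> = Q * B * P * A'"
    unfolding A'_eq using A Bc w(6,7) by (simp add: assoc_mult_mat[of _ n n _ n _ n])
  finally show ?thesis
    using Bc w(5-7) by (simp add: mem_twisted_centralizer[of _ n])
qed

text \<open>If \<open>Q = inverse P\<close> and \<open>A = P * A' * Q\<close>, the isomorphism is \<open>B \<mapsto> Q * B * P\<close>.\<close>

lemma twisted_centralizer_iso_similar: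
  fixes A A' :: "'a :: field mat"
  assumes "similar_mat A A'"
  shows "vectorspace_iso class_ring (twisted_centralizer_space A l) (twisted_centralizer_space A' l)"
proof -
  from assms obtain P Q where wit: "similar_mat_wit A A' P Q" unfolding similar_mat_def by blast
  define n where "n = dim_row A"
  note w = similar_mat_witD[OF n_def wit]
  have cancel: "P * (Q * B * P) * Q = B" "Q * (P * B * Q) * P = B" if B: "B \<in> carrier_mat n n" for B
  proof -
    have "P * (Q * B * P) * Q = (P * Q) * B * (P * Q)" "Q * (P * B * Q) * P = (Q * P) * B * (Q * P)"
      using B w(6,7) by (simp_all add: assoc_mult_mat[of _ n n _ n _ n])
    then show "P * (Q * B * P) * Q = B" "Q * (P * B * Q) * P = B"
      using B unfolding w(1,2) by simp_all
  qed
  have carr: "twisted_centralizer A l \<subseteq> carrier_mat n n" "twisted_centralizer A' l \<subseteq> carrier_mat n n"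
    using mem_twisted_centralizer[OF w(4)] mem_twisted_centralizer[OF w(5)] by auto
  show ?thesis
  proof (rule vectorspace_isoI[of _ _ _ "\<lambda>B. Q * B * P"])
    show "bij_betw (\<lambda>B. Q * B * P) (carrier (twisted_centralizer_space A l))
        (carrier (twisted_centralizer_space A' l))"
      using carr cancel twisted_centralizer_conjugate[OF wit w(4), of _ l]
        twisted_centralizer_conjugate[OF similar_mat_wit_sym[OF wit] w(5), of _ l]
      by (intro bij_betw_byWitness[of _ "\<lambda>B. P * B * Q"]) auto
  next
    fix x y assume "x \<in> carrier (twisted_centralizer_space A l)" "y \<in> carrier (twisted_centralizer_space A l)"
    then have "x \<in> carrier_mat n n" "y \<in> carrier_mat n n" using carr by auto
    then show "Q * (x \<oplus>\<^bsub>twisted_centralizer_space A l\<^esub> y) * P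
        = Q * x * P \<oplus>\<^bsub>twisted_centralizer_space A' l\<^esub> Q * y * P"
      using w(6,7) by (simp add: mult_add_distrib_mat[of _ n n] add_mult_distrib_mat[of _ n n])
  next
    fix c x assume "x \<in> carrier (twisted_centralizer_space A l)"
    then have "x \<in> carrier_mat n n" using carr by auto
    then show "Q * (c \<odot>\<^bsub>twisted_centralizer_space A l\<^esub> x) * P
        = c \<odot>\<^bsub>twisted_centralizer_space A' l\<^esub> (Q * x * P)"
      using w(6,7) by (simp add: mult_smult_distrib[of _ n n _ n] mult_smult_assoc_mat[of _ n n _ n])
  qed (use w(4,5) vectorspace_twisted_centralizer in auto)
qed

lemma four_block_mat_inject:
  assumes "A \<in> carrier_mat m m'" "B \<in> carrier_mat m k'" "C \<in> carrier_mat k m'" "D \<in> carrier_mat k k'"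
    and "A' \<in> carrier_mat m m'" "B' \<in> carrier_mat m k'" "C' \<in> carrier_mat k m'" "D' \<in> carrier_mat k k'"
  shows "four_block_mat A B C D = four_block_mat A' B' C' D' \<longleftrightarrow> A = A' \<and> B = B' \<and> C = C' \<and> D = D'"
proof
  assume eq: "four_block_mat A B C D = four_block_mat A' B' C' D'"
  have entry: "four_block_mat A B C D $$ ij = four_block_mat A' B' C' D' $$ ij" for ij
    by (simp only: eq)
  have "A = A'"
  proof (rule eq_matI)
    fix i j assume "i < dim_row A'" "j < dim_col A'"
    then show "A $$ (i,j) = A' $$ (i,j)" using entry[of "(i,j)"] assms by simp
  qed (use assms in auto)
  moreover have "B = B'"
  proof (rule eq_matI)
    fix i j assume "i < dim_row B'" "j < dim_col B'"
    then show "B $$ (i,j) = B' $$ (i,j)" using entry[of "(i,j + m')"] assms by simp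
  qed (use assms in auto)
  moreover have "C = C'"
  proof (rule eq_matI)
    fix i j assume "i < dim_row C'" "j < dim_col C'"
    then show "C $$ (i,j) = C' $$ (i,j)" using entry[of "(i + m,j)"] assms by simp
  qed (use assms in auto)
  moreover have "D = D'"
  proof (rule eq_matI)
    fix i j assume "i < dim_row D'" "j < dim_col D'"
    then show "D $$ (i,j) = D' $$ (i,j)" using entry[of "(i + m,j + m')"] assms by simp
  qed (use assms in auto)
  ultimately show "A = A' \<and> B = B' \<and> C = C' \<and> D = D'" by simp
qed simp

text \<open>For block diagonal matrices the defining equation decouples: the diagonal blocks satisfy the same
  kind of equation, and the off-diagonal ones are twisted intertwiners between \<open>A1\<close> and \<open>A2\<close>.\<close>

lemma mem_twisted_centralizer_block_diagonal:
  fixes A1 A2 :: "'a :: field mat"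
  assumes A1: "A1 \<in> carrier_mat m m" and A2: "A2 \<in> carrier_mat k k"
    and B: "B1 \<in> carrier_mat m m" "B2 \<in> carrier_mat m k" "B3 \<in> carrier_mat k m" "B4 \<in> carrier_mat k k"
  shows "four_block_mat B1 B2 B3 B4 \<in> twisted_centralizer (four_block_mat A1 (0\<^sub>m m k) (0\<^sub>m k m) A2) l
    \<longleftrightarrow> B1 \<in> twisted_centralizer A1 l \<and> A1 * B2 = l \<cdot>\<^sub>m (B2 * A2) \<and>
      A2 * B3 = l \<cdot>\<^sub>m (B3 * A1) \<and> B4 \<in> twisted_centralizer A2 l"
proof -
  let ?A = "four_block_mat A1 (0\<^sub>m m k) (0\<^sub>m k m) A2" and ?B = "four_block_mat B1 B2 B3 B4"
  have "?A \<in> carrier_mat (m + k) (m + k)" "?B \<in> carrier_mat (m + k) (m + k)"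
    using A1 A2 B by auto
  then have "?B \<in> twisted_centralizer ?A l \<longleftrightarrow> ?A * ?B = l \<cdot>\<^sub>m (?B * ?A)"
    by (simp add: mem_twisted_centralizer)
  also have "?A * ?B = four_block_mat (A1 * B1) (A1 * B2) (A2 * B3) (A2 * B4)"
    using A1 A2 B by (subst mult_four_block_mat[of _ m m _ k _ k _ _ m _ k]; simp)
  also have "?B * ?A = four_block_mat (B1 * A1) (B2 * A2) (B3 * A1) (B4 * A2)"
    using A1 A2 B by (subst mult_four_block_mat[of _ m m _ k _ k _ _ m _ k]; simp)
  also have "l \<cdot>\<^sub>m \<dots> = four_block_mat (l \<cdot>\<^sub>m (B1 * A1)) (l \<cdot>\<^sub>m (B2 * A2))
      (l \<cdot>\<^sub>m (B3 * A1)) (l \<cdot>\<^sub>m (B4 * A2))"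
    using A1 A2 B by (intro smult_four_block_mat[of _ m m _ k _ k]) auto
  also have "four_block_mat (A1 * B1) (A1 * B2) (A2 * B3) (A2 * B4) = \<dots> \<longleftrightarrow>
      A1 * B1 = l \<cdot>\<^sub>m (B1 * A1) \<and> A1 * B2 = l \<cdot>\<^sub>m (B2 * A2) \<and>
      A2 * B3 = l \<cdot>\<^sub>m (B3 * A1) \<and> A2 * B4 = l \<cdot>\<^sub>m (B4 * A2)"
    using A1 A2 B by (intro four_block_mat_inject[of _ m m _ k _ k]) auto
  finally show ?thesis
    using A1 A2 B by (simp add: mem_twisted_centralizer)
qed

text \<open>When there are no nonzero twisted intertwiners between the two blocks, members of the twisted
  centralizer are block diagonal and reading off the diagonal blocks is an isomorphism.\<close>

lemma twisted_centralizer_iso_block_diagonal: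
  fixes A1 A2 :: "'a :: field mat"
  assumes A1: "A1 \<in> carrier_mat m m" and A2: "A2 \<in> carrier_mat k k"
    and off12: "\<And>B. B \<in> carrier_mat m k \<Longrightarrow> A1 * B = l \<cdot>\<^sub>m (B * A2) \<Longrightarrow> B = 0\<^sub>m m k"
    and off21: "\<And>B. B \<in> carrier_mat k m \<Longrightarrow> A2 * B = l \<cdot>\<^sub>m (B * A1) \<Longrightarrow> B = 0\<^sub>m k m"
  shows "vectorspace_iso class_ring
    (twisted_centralizer_space (four_block_mat A1 (0\<^sub>m m k) (0\<^sub>m k m) A2) l)
    (direct_sum (twisted_centralizer_space A1 l) (twisted_centralizer_space A2 l))"
proof -
  let ?A = "four_block_mat A1 (0\<^sub>m m k) (0\<^sub>m k m) A2"
  let ?S = "direct_sum (twisted_centralizer_space A1 l) (twisted_centralizer_space A2 l)"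
  define T where "T B = (mat m m (\<lambda>(i,j). B $$ (i,j)), mat k k (\<lambda>(i,j). B $$ (i + m,j + m)))"
    for B :: "'a mat"
  define J where "J = (\<lambda>(B1,B4). four_block_mat B1 (0\<^sub>m m k) (0\<^sub>m k m) B4 :: 'a mat)"
  have A: "?A \<in> carrier_mat (m + k) (m + k)" using A1 A2 by simp
  have carr: "B \<in> carrier_mat (m + k) (m + k)" if "B \<in> twisted_centralizer ?A l" for B
    using that mem_twisted_centralizer[OF A] by simp
  have TJ: "T (J (B1,B4)) = (B1,B4)" if "B1 \<in> carrier_mat m m" "B4 \<in> carrier_mat k k" for B1 B4
    using that unfolding T_def J_def by auto
  have fwd: "T B \<in> twisted_centralizer A1 l \<times> twisted_centralizer A2 l \<and> J (T B) = B"
    if B: "B \<in> twisted_centralizer ?A l" for B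
  proof -
    obtain B1 B2 B3 B4 where s: "split_block B m m = (B1,B2,B3,B4)" by (cases "split_block B m m")
    have "dim_row B = m + k" "dim_col B = m + k" using carr[OF B] by auto
    note b = split_block[OF s this]
    have *: "B1 \<in> twisted_centralizer A1 l" "B4 \<in> twisted_centralizer A2 l" "B2 = 0\<^sub>m m k" "B3 = 0\<^sub>m k m"
      using B off12[OF b(2)] off21[OF b(3)]
      unfolding b(5) mem_twisted_centralizer_block_diagonal[OF A1 A2 b(1-4)] by auto
    then have "B = J (B1,B4)" using b(5) unfolding J_def by simp
    then show ?thesis using * TJ[OF b(1,4)] by simp
  qed
  have bwd: "J (B1,B4) \<in> twisted_centralizer ?A l"
    if "B1 \<in> twisted_centralizer A1 l" "B4 \<in> twisted_centralizer A2 l" for B1 B4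
    using that A1 A2 mem_twisted_centralizer_block_diagonal[OF A1 A2, of B1 "0\<^sub>m m k" "0\<^sub>m k m" B4 l]
    unfolding J_def by (auto simp: mem_twisted_centralizer)
  show ?thesis
  proof (rule vectorspace_isoI[of _ _ _ T])
    show "vectorspace class_ring ?S"
      using A1 A2 by (intro direct_sum_is_vs vectorspace_twisted_centralizer)
    show "bij_betw T (carrier (twisted_centralizer_space ?A l)) (carrier ?S)"
    proof (rule bij_betw_byWitness[of _ J])
      show "\<forall>B \<in> carrier (twisted_centralizer_space ?A l). J (T B) = B"
        using fwd by simp
      show "\<forall>p \<in> carrier ?S. T (J p) = p"
        using TJ mem_twisted_centralizer[OF A1] mem_twisted_centralizer[OF A2]
        by (auto simp: direct_sum_def)
      show "T ` carrier (twisted_centralizer_space ?A l) \<subseteq> carrier ?S"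
        by (simp add: direct_sum_def image_subset_iff fwd)
      show "J ` carrier ?S \<subseteq> carrier (twisted_centralizer_space ?A l)"
        using bwd by (auto simp: direct_sum_def)
    qed
  next
    fix x y
    assume "x \<in> carrier (twisted_centralizer_space ?A l)" "y \<in> carrier (twisted_centralizer_space ?A l)"
    then have "x \<in> carrier_mat (m + k) (m + k)" "y \<in> carrier_mat (m + k) (m + k)" using carr by auto
    then show "T (x \<oplus>\<^bsub>twisted_centralizer_space ?A l\<^esub> y) = T x \<oplus>\<^bsub>?S\<^esub> T y"
      unfolding T_def direct_sum_def by auto
  next
    fix c x
    assume "x \<in> carrier (twisted_centralizer_space ?A l)"
    then have "x \<in> carrier_mat (m + k) (m + k)" using carr by auto
    then show "T (c \<odot>\<^bsub>twisted_centralizer_space ?A l\<^esub> x) = c \<odot>\<^bsub>?S\<^esub> T x"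
      unfolding T_def direct_sum_def by auto
  qed (rule vectorspace_twisted_centralizer[OF A])
qed

section \<open>Decomposition of the twisted centralizer\<close>

theorem theorem2p4:
  fixes A :: "'a :: field mat" and n m p :: nat and \<alpha> l :: 'a and f :: "'a poly"
  assumes "CHAR('a) = p" and "p > 0"
    and "A \<in> carrier_mat n n"
    and "l \<noteq> 0"
    and "char_poly A = [:- \<alpha>, 1:] ^ m * f"
    and "poly f \<alpha> * poly f (l * \<alpha>) * poly f (inverse l * \<alpha>) \<noteq> 0"
  shows "\<exists>k A1 A2.
           A1 \<in> carrier_mat m m \<and> A2 \<in> carrier_mat k k \<and>
           similar_mat A (diag_block_mat [A1, A2]) \<and>
           char_poly A1 = [:- \<alpha>, 1:] ^ m \<and> char_poly A2 = f \<and>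
           vectorspace_iso class_ring
             (twisted_centralizer_space A l)
             (direct_sum (twisted_centralizer_space A1 l) (twisted_centralizer_space A2 l))"
proof -
  have roots: "poly f \<alpha> \<noteq> 0" "poly f (l * \<alpha>) \<noteq> 0" "poly f (inverse l * \<alpha>) \<noteq> 0"
    using assms(6) by auto
  from similar_split_root_power[OF assms(3,5) roots(1)] obtain k A1 A2
    where A1: "A1 \<in> carrier_mat m m" and ut: "upper_triangular A1"
      and diag: "\<And>i. i < m \<Longrightarrow> A1 $$ (i,i) = \<alpha>"
      and A2: "A2 \<in> carrier_mat k k" and f: "char_poly A2 = f"
      and sim: "similar_mat A (four_block_mat A2 (0\<^sub>m k m) (0\<^sub>m m k) A1)"
    by blast
  let ?A' = "four_block_mat A1 (0\<^sub>m m k) (0\<^sub>m k m) A2"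
  have sim': "similar_mat A ?A'"
    using similar_mat_trans[OF sim similar_swap_blocks[OF A2 A1]] .
  have "diag_mat A1 = replicate m \<alpha>"
    using A1 diag by (intro nth_equalityI) (auto simp: diag_mat_def)
  then have cA1: "char_poly A1 = [:- \<alpha>, 1:] ^ m"
    by (simp add: char_poly_upper_triangular[OF A1 ut])
  \<comment> \<open>The scalar \<open>l\<close> is absorbed into one factor, so that the equations become untwisted: the
    eigenvalue \<open>\<alpha>\<close> of \<open>A1\<close> is compared with those of \<open>l A2\<close> here, and the eigenvalue \<open>l \<alpha>\<close> of
    \<open>l A1\<close> with those of \<open>A2\<close> afterwards.\<close>
  have B12: "B = 0\<^sub>m m k" if B: "B \<in> carrier_mat m k" and eq: "A1 * B = l \<cdot>\<^sub>m (B * A2)" for B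
  proof (rule intertwiner_upper_triangular_left[OF A1 ut _ B])
    show "A1 * B = B * (l \<cdot>\<^sub>m A2)" using eq mult_smult_distrib[OF B A2] by simp
    show "\<not> eigenvalue (l \<cdot>\<^sub>m A2) (A1 $$ (i,i))" if "i < m" for i
      using eigenvalue_smult[OF A2 _ assms(4), of \<alpha>] roots(3) f
      by (auto simp: diag[OF that] eigenvalue_root_char_poly[OF A2])
  qed (use A2 in simp)
  have B21: "B = 0\<^sub>m k m" if B: "B \<in> carrier_mat k m" and eq: "A2 * B = l \<cdot>\<^sub>m (B * A1)" for B
  proof (rule intertwiner_upper_triangular_right[of "l \<cdot>\<^sub>m A1", OF _ _ A2 B])
    show "A2 * B = B * (l \<cdot>\<^sub>m A1)" using eq mult_smult_distrib[OF B A1] by simp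
    show "upper_triangular (l \<cdot>\<^sub>m A1)"
      using ut A1 by (auto simp: upper_triangular_def)
    show "\<not> eigenvalue A2 ((l \<cdot>\<^sub>m A1) $$ (i,i))" if "i < m" for i
      using that A1 roots(2) f by (simp add: diag[OF that] eigenvalue_root_char_poly[OF A2])
  qed (use A1 in simp)
  have "vectorspace_iso class_ring (twisted_centralizer_space A l)
      (direct_sum (twisted_centralizer_space A1 l) (twisted_centralizer_space A2 l))"
    using vectorspace_iso_trans[OF twisted_centralizer_iso_similar[OF sim']
        twisted_centralizer_iso_block_diagonal[OF A1 A2 B12 B21]] .
  moreover have "diag_block_mat [A1, A2] = ?A'"
    using A1 A2 by (subst diag_block_mat.simps(2)) (simp add: Let_def del: diag_block_mat.simps)
  ultimately show ?thesis
    using A1 A2 cA1 f sim' by (intro exI[of _ k] exI[of _ A1] exI[of _ A2]) simp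
qed

end
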